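(* Let $G$ be a group, let $R$ be a unital ring and let $R\star_\alpha^\omega G$ be a unital partial crossed product of $G$ over $R$, with its $G$-grading $(R\star_\alpha^\omega G)_g=D_g\delta_g$. Then $R\star_\alpha^\omega G$ is graded von Neumann regular if and only if $R$ is von Neumann regular.
   Context: Rings are associative; a ring is called unital if it has a non-zero multiplicative identity. A ring $R$ is von Neumann regular if for every $x\in R$ there is $y\in R$ with $x=xyx$. A $G$-graded ring $S=\bigoplus_{g\in G}S_g$ is graded von Neumann regular if for every $g\in G$ and $a\in S_g$ there is $s\in S$ with $a=asa$. Let $e$ be the neutral element of $G$. A unital twisted partial action of $G$ on $R$ is a triple $(\{\alpha_g\}_{g\in G},\{D_g\}_{g\in G},\{w_{g,h}\}_{(g,h)\in G\times G})$ where, for each $g\in G$, $D_g$ is a two-sided ideal of $R$ of the form $D_g=1_gR$ with $1_g$ a central idempotent of $R$ (possibly zero), $\alpha_g\colon D_{g^{-1}}\to D_g$ is a ring isomorphism, and for each $(g,h)\in G\times G$, $w_{g,h}$ is an invertible element of the ring $D_gD_{gh}$ (with identity $1_g1_{gh}$), such that for all $g,h,l\in G$: (P1) $D_e=R$ and $\alpha_e=\mathrm{id}_R$; (P2) $\alpha_g(D_{g^{-1}}D_h)=D_gD_{gh}$; (P3) $\alpha_g(\alpha_h(r))=w_{g,h}\alpha_{gh}(r)w_{g,h}^{-1}$ for all $r\in D_{h^{-1}}D_{(gh)^{-1}}$; (P4) $w_{e,g}=w_{g,e}=1_g$; (P5) $\alpha_g(rw_{h,l})w_{g,hl}=\alpha_g(r)w_{g,h}w_{gh,l}$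 for all $r\in D_{g^{-1}}D_hD_{hl}$. The associated unital partial crossed product is $R\star_\alpha^\omega G=\bigoplus_{g\in G}D_g\delta_g$, where the $\delta_g$ are formal symbols, with componentwise addition and multiplication determined by $(a\delta_g)(b\delta_h)=a\,\alpha_g(b1_{g^{-1}})\,w_{g,h}\,\delta_{gh}$ for $a\in D_g$, $b\in D_h$. It is an associative unital ring, $G$-graded by $(R\star_\alpha^\omega G)_g=D_g\delta_g$. *)

theory Defs
  imports "HOL-Algebra.Ideal_Product" "HOL-Algebra.QuotRing"
begin

definition von_neumann_regular :: "('a, 'm) ring_scheme \<Rightarrow> bool" where
  "von_neumann_regular R \<longleftrightarrow>
     (\<forall>x \<in> carrier R. \<exists>y \<in> carrier R. x = x \<otimes>\<^bsub>R\<^esub> y \<otimes>\<^bsub>R\<^esub> x)"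

text \<open>\<open>C g\<close> is the homogeneous component of degree \<open>g\<close>. The element \<open>s\<close> is an arbitrary
  element of \<open>S\<close>, not necessarily homogeneous.\<close>

definition graded_von_neumann_regular ::
  "('g, 'n) monoid_scheme \<Rightarrow> ('a, 'm) ring_scheme \<Rightarrow> ('g \<Rightarrow> 'a set) \<Rightarrow> bool" where
  "graded_von_neumann_regular G S C \<longleftrightarrow>
     (\<forall>g \<in> carrier G. \<forall>a \<in> C g. \<exists>s \<in> carrier S. a = a \<otimes>\<^bsub>S\<^esub> s \<otimes>\<^bsub>S\<^esub> a)"

text \<open>An ideal \<open>I\<close> of \<open>R\<close> generated by a central idempotent \<open>e\<close> is a ring in its own right,
  with the operations of \<open>R\<close> and identity \<open>e\<close> (the zero ring if \<open>e\<close> is zero).\<close>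

definition ideal_as_ring :: "('a, 'm) ring_scheme \<Rightarrow> 'a set \<Rightarrow> 'a \<Rightarrow> ('a, 'm) ring_scheme" where
  "ideal_as_ring R I e = R\<lparr>carrier := I, one := e\<rparr>"

text \<open>The element \<open>u g\<close> is the central idempotent usually written \<open>1\<^sub>g\<close>. It is determined by
  \<open>D g\<close>, being the identity of that ring, so it is no extra datum. The inverse in \<open>P3\<close>
  is taken in the ring \<open>D g \<cdot> D (g \<otimes> h)\<close>, whose identity is \<open>u g \<otimes> u (g \<otimes> h)\<close>.\<close>

locale unital_twisted_partial_action = G: group G + R: ring R
  for G :: "('g, 'n) monoid_scheme" (structure)
    and R :: "('a, 'm) ring_scheme" (structure)
    and \<alpha> :: "'g \<Rightarrow> 'a \<Rightarrow> 'a"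
    and D :: "'g \<Rightarrow> 'a set"
    and w :: "'g \<Rightarrow> 'g \<Rightarrow> 'a"
    and u :: "'g \<Rightarrow> 'a" +
  assumes u_closed: "g \<in> carrier G \<Longrightarrow> u g \<in> carrier R"
    and u_idem: "g \<in> carrier G \<Longrightarrow> u g \<otimes>\<^bsub>R\<^esub> u g = u g"
    and u_central: "\<lbrakk>g \<in> carrier G; r \<in> carrier R\<rbrakk> \<Longrightarrow> u g \<otimes>\<^bsub>R\<^esub> r = r \<otimes>\<^bsub>R\<^esub> u g"
    and D_ideal: "g \<in> carrier G \<Longrightarrow> ideal (D g) R"
    and D_eq: "g \<in> carrier G \<Longrightarrow> D g = u g <#\<^bsub>R\<^esub> carrier R"
    and \<alpha>_iso: "g \<in> carrier G \<Longrightarrow>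
      \<alpha> g \<in> ring_iso (ideal_as_ring R (D (inv\<^bsub>G\<^esub> g)) (u (inv\<^bsub>G\<^esub> g))) (ideal_as_ring R (D g) (u g))"
    and w_unit: "\<lbrakk>g \<in> carrier G; h \<in> carrier G\<rbrakk> \<Longrightarrow>
      w g h \<in> Units (ideal_as_ring R (D g \<cdot>\<^bsub>R\<^esub> D (g \<otimes>\<^bsub>G\<^esub> h)) (u g \<otimes>\<^bsub>R\<^esub> u (g \<otimes>\<^bsub>G\<^esub> h)))"
    and P1_D: "D \<one>\<^bsub>G\<^esub> = carrier R"
    and P1_\<alpha>: "r \<in> carrier R \<Longrightarrow> \<alpha> \<one>\<^bsub>G\<^esub> r = r"
    and P2: "\<lbrakk>g \<in> carrier G; h \<in> carrier G\<rbrakk> \<Longrightarrow>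
      \<alpha> g ` (D (inv\<^bsub>G\<^esub> g) \<cdot>\<^bsub>R\<^esub> D h) = D g \<cdot>\<^bsub>R\<^esub> D (g \<otimes>\<^bsub>G\<^esub> h)"
    and P3: "\<lbrakk>g \<in> carrier G; h \<in> carrier G; r \<in> D (inv\<^bsub>G\<^esub> h) \<cdot>\<^bsub>R\<^esub> D (inv\<^bsub>G\<^esub> (g \<otimes>\<^bsub>G\<^esub> h))\<rbrakk> \<Longrightarrow>
      \<alpha> g (\<alpha> h r) = w g h \<otimes>\<^bsub>R\<^esub> \<alpha> (g \<otimes>\<^bsub>G\<^esub> h) r \<otimes>\<^bsub>R\<^esub>
        inv\<^bsub>ideal_as_ring R (D g \<cdot>\<^bsub>R\<^esub> D (g \<otimes>\<^bsub>G\<^esub> h)) (u g \<otimes>\<^bsub>R\<^esub> u (g \<otimes>\<^bsub>G\<^esub> h))\<^esub> (w g h)"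
    and P4_left: "g \<in> carrier G \<Longrightarrow> w \<one>\<^bsub>G\<^esub> g = u g"
    and P4_right: "g \<in> carrier G \<Longrightarrow> w g \<one>\<^bsub>G\<^esub> = u g"
    and P5: "\<lbrakk>g \<in> carrier G; h \<in> carrier G; l \<in> carrier G;
        r \<in> D (inv\<^bsub>G\<^esub> g) \<cdot>\<^bsub>R\<^esub> D h \<cdot>\<^bsub>R\<^esub> D (h \<otimes>\<^bsub>G\<^esub> l)\<rbrakk> \<Longrightarrow>
      \<alpha> g (r \<otimes>\<^bsub>R\<^esub> w h l) \<otimes>\<^bsub>R\<^esub> w g (h \<otimes>\<^bsub>G\<^esub> l) = \<alpha> g r \<otimes>\<^bsub>R\<^esub> w g h \<otimes>\<^bsub>R\<^esub> w (g \<otimes>\<^bsub>G\<^esub> h) l"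

text \<open>The formal sum of the \<open>a\<^sub>g \<delta>\<^sub>g\<close> is encoded as the finitely supported function
  \<open>g \<mapsto> a\<^sub>g\<close> on \<open>carrier G\<close> (undefined elsewhere). The multiplication is the biadditive
  extension of \<open>(a \<delta>\<^sub>g)(b \<delta>\<^sub>h) = a \<alpha>\<^sub>g(b 1\<^bsub>g\<^sup>-\<^sup>1\<^esub>) w\<^bsub>g,h\<^esub> \<delta>\<^bsub>gh\<^esub>\<close>.\<close>

definition delta ::
  "('g, 'n) monoid_scheme \<Rightarrow> ('a, 'm) ring_scheme \<Rightarrow> 'a \<Rightarrow> 'g \<Rightarrow> 'g \<Rightarrow> 'a" where
  "delta G R a g = (\<lambda>k \<in> carrier G. if k = g then a else \<zero>\<^bsub>R\<^esub>)"

definition supp ::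
  "('g, 'n) monoid_scheme \<Rightarrow> ('a, 'm) ring_scheme \<Rightarrow> ('g \<Rightarrow> 'a) \<Rightarrow> 'g set" where
  "supp G R x = {g \<in> carrier G. x g \<noteq> \<zero>\<^bsub>R\<^esub>}"

definition partial_crossed_product ::
  "('g, 'n) monoid_scheme \<Rightarrow> ('a, 'm) ring_scheme \<Rightarrow> ('g \<Rightarrow> 'a \<Rightarrow> 'a) \<Rightarrow> ('g \<Rightarrow> 'a set) \<Rightarrow>
    ('g \<Rightarrow> 'g \<Rightarrow> 'a) \<Rightarrow> ('g \<Rightarrow> 'a) \<Rightarrow> ('g \<Rightarrow> 'a) ring" where
  "partial_crossed_product G R \<alpha> D w u =
    \<lparr>carrier = {x \<in> (\<Pi>\<^sub>E g \<in> carrier G. D g). finite (supp G R x)},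
     mult = (\<lambda>x y. \<lambda>k \<in> carrier G.
       finsum R (\<lambda>(g, h). x g \<otimes>\<^bsub>R\<^esub> \<alpha> g (y h \<otimes>\<^bsub>R\<^esub> u (inv\<^bsub>G\<^esub> g)) \<otimes>\<^bsub>R\<^esub> w g h)
         {(g, h) \<in> supp G R x \<times> supp G R y. g \<otimes>\<^bsub>G\<^esub> h = k}),
     one = delta G R \<one>\<^bsub>R\<^esub> \<one>\<^bsub>G\<^esub>,
     zero = (\<lambda>k \<in> carrier G. \<zero>\<^bsub>R\<^esub>),
     add = (\<lambda>x y. \<lambda>k \<in> carrier G. x k \<oplus>\<^bsub>R\<^esub> y k)\<rparr>"

definition crossed_component ::
  "('g, 'n) monoid_scheme \<Rightarrow> ('a, 'm) ring_scheme \<Rightarrow> ('g \<Rightarrow> 'a set) \<Rightarrow> 'g \<Rightarrow> ('g \<Rightarrow> 'a) set" where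
  "crossed_component G R D g = (\<lambda>a. delta G R a g) ` D g"

context unital_twisted_partial_action
begin

lemma D_carrier: "g \<in> carrier G \<Longrightarrow> a \<in> D g \<Longrightarrow> a \<in> carrier R"
  by (rule ideal.Icarr[OF D_ideal])

lemma \<alpha>_closed:
  assumes "g \<in> carrier G" "a \<in> D (inv\<^bsub>G\<^esub> g)"
  shows "\<alpha> g a \<in> D g"
  using ring_iso_memE(1)[OF \<alpha>_iso[OF assms(1)]] assms(2) by (simp add: ideal_as_ring_def)

lemma w_in_prod:
  assumes "g \<in> carrier G" "h \<in> carrier G"
  shows "w g h \<in> D g \<cdot>\<^bsub>R\<^esub> D (g \<otimes>\<^bsub>G\<^esub> h)"
proof -
  have "w g h \<in> carrier (ideal_as_ring R (D g \<cdot>\<^bsub>R\<^esub> D (g \<otimes>\<^bsub>G\<^esub> h)) (u g \<otimes>\<^bsub>R\<^esub> u (g \<otimes>\<^bsub>G\<^esub> h)))"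
    using w_unit[OF assms] unfolding Units_def by (rule CollectE) (elim conjE)
  then show ?thesis
    by (simp add: ideal_as_ring_def)
qed

lemma w_closed:
  assumes "g \<in> carrier G" "h \<in> carrier G"
  shows "w g h \<in> D (g \<otimes>\<^bsub>G\<^esub> h)" "w g h \<in> carrier R"
proof -
  have "D g \<cdot>\<^bsub>R\<^esub> D (g \<otimes>\<^bsub>G\<^esub> h) \<subseteq> D (g \<otimes>\<^bsub>G\<^esub> h)"
    using R.ideal_prod_inter[OF D_ideal[OF assms(1)] D_ideal[OF G.m_closed[OF assms]]] by simp
  then show "w g h \<in> D (g \<otimes>\<^bsub>G\<^esub> h)"
    using w_in_prod[OF assms] by (rule subsetD)
  then show "w g h \<in> carrier R"
    by (rule D_carrier[OF G.m_closed[OF assms]])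
qed

lemma D_mult_u:
  assumes "g \<in> carrier G" "b \<in> carrier R"
  shows "b \<otimes>\<^bsub>R\<^esub> u g \<in> D g"
proof -
  have "u g \<otimes>\<^bsub>R\<^esub> b \<in> D g"
    unfolding D_eq[OF assms(1)] l_coset_def using assms(2) by blast
  then show ?thesis
    by (simp only: u_central[OF assms])
qed

lemma delta_closed:
  assumes "g \<in> carrier G" "a \<in> D g"
  shows "delta G R a g \<in> carrier (partial_crossed_product G R \<alpha> D w u)"
proof -
  have "supp G R (delta G R a g) \<subseteq> {g}"
    by (auto simp: supp_def delta_def)
  then have "finite (supp G R (delta G R a g))"
    using finite_subset by blast
  moreover have "\<zero>\<^bsub>R\<^esub> \<in> D k" if "k \<in> carrier G" for k
    using D_ideal[OF that] by (simp add: additive_subgroup.zero_closed ideal.axioms(1))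
  ultimately show ?thesis
    using assms by (auto simp: partial_crossed_product_def delta_def PiE_def)
qed

lemma delta_mult:
  assumes g: "g \<in> carrier G" and h: "h \<in> carrier G" and a: "a \<in> D g" and b: "b \<in> D h"
  shows "delta G R a g \<otimes>\<^bsub>partial_crossed_product G R \<alpha> D w u\<^esub> delta G R b h =
    delta G R (a \<otimes>\<^bsub>R\<^esub> \<alpha> g (b \<otimes>\<^bsub>R\<^esub> u (inv\<^bsub>G\<^esub> g)) \<otimes>\<^bsub>R\<^esub> w g h) (g \<otimes>\<^bsub>G\<^esub> h)"
proof -
  define c where "c = a \<otimes>\<^bsub>R\<^esub> \<alpha> g (b \<otimes>\<^bsub>R\<^esub> u (inv\<^bsub>G\<^esub> g)) \<otimes>\<^bsub>R\<^esub> w g h"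
  have aR: "a \<in> carrier R" and bR: "b \<in> carrier R"
    by (rule D_carrier[OF g a], rule D_carrier[OF h b])
  have \<alpha>R: "\<alpha> g (x \<otimes>\<^bsub>R\<^esub> u (inv\<^bsub>G\<^esub> g)) \<in> carrier R" if "x \<in> carrier R" for x
    by (intro D_carrier[OF g] \<alpha>_closed[OF g] D_mult_u G.inv_closed g that)
  have cR: "c \<in> carrier R"
    unfolding c_def using aR \<alpha>R[OF bR] w_closed(2)[OF g h] by simp
  have c0: "c = \<zero>\<^bsub>R\<^esub>" if "a = \<zero>\<^bsub>R\<^esub> \<or> b = \<zero>\<^bsub>R\<^esub>"
  proof (cases "a = \<zero>\<^bsub>R\<^esub>")
    case True
    then show ?thesis
      unfolding c_def using \<alpha>R[OF bR] w_closed(2)[OF g h] by simp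
  next
    case False
    then have b0: "b = \<zero>\<^bsub>R\<^esub>" using that by blast
    let ?z = "\<alpha> g \<zero>\<^bsub>R\<^esub>"
    have z: "\<zero>\<^bsub>R\<^esub> \<in> D (inv\<^bsub>G\<^esub> g)"
      using D_ideal g by (simp add: additive_subgroup.zero_closed ideal.axioms(1))
    have "\<alpha> g (\<zero>\<^bsub>R\<^esub> \<oplus>\<^bsub>R\<^esub> \<zero>\<^bsub>R\<^esub>) = ?z \<oplus>\<^bsub>R\<^esub> ?z"
      using ring_iso_memE(3)[OF \<alpha>_iso[OF g], of "\<zero>\<^bsub>R\<^esub>" "\<zero>\<^bsub>R\<^esub>"] z
      by (simp add: ideal_as_ring_def)
    moreover have zR: "?z \<in> carrier R"
      by (rule D_carrier[OF g \<alpha>_closed[OF g z]])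
    ultimately have "?z = \<zero>\<^bsub>R\<^esub>"
      by (simp add: R.add.l_cancel_one')
    then show ?thesis
      unfolding c_def b0 using aR w_closed(2)[OF g h] u_closed g by simp
  qed
  have supp: "supp G R (delta G R x k) = (if x = \<zero>\<^bsub>R\<^esub> then {} else {k})"
    if "k \<in> carrier G" for x k
    using that by (auto simp: supp_def delta_def)
  have eval: "delta G R x k k = x" if "k \<in> carrier G" for x k
    using that by (simp add: delta_def)
  show ?thesis
    unfolding c_def[symmetric]
  proof (rule ext)
    fix k
    let ?S = "{(i, j) \<in> supp G R (delta G R a g) \<times> supp G R (delta G R b h). i \<otimes>\<^bsub>G\<^esub> j = k}"
    let ?f = "\<lambda>(i, j). delta G R a g i \<otimes>\<^bsub>R\<^esub>
       \<alpha> i (delta G R b h j \<otimes>\<^bsub>R\<^esub> u (inv\<^bsub>G\<^esub> i)) \<otimes>\<^bsub>R\<^esub> w i j"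
    have "finsum R ?f ?S = (if k = g \<otimes>\<^bsub>G\<^esub> h then c else \<zero>\<^bsub>R\<^esub>)"
    proof (cases "a = \<zero>\<^bsub>R\<^esub> \<or> b = \<zero>\<^bsub>R\<^esub> \<or> k \<noteq> g \<otimes>\<^bsub>G\<^esub> h")
      case True
      then have "?S = {}" by (auto simp: supp[OF g] supp[OF h])
      then show ?thesis using True c0 by (auto simp del: Collect_empty_eq)
    next
      case False
      then have S: "?S = insert (g, h) {}" by (auto simp: supp[OF g] supp[OF h])
      have f: "?f (g, h) = c" by (simp add: eval[OF g] eval[OF h] c_def)
      have "finsum R ?f (insert (g, h) {}) = ?f (g, h) \<oplus>\<^bsub>R\<^esub> finsum R ?f {}"
        using cR f by (intro R.finsum_insert) auto
      then have "finsum R ?f ?S = c"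
        unfolding S f using cR by simp
      then show ?thesis using False by simp
    qed
    then show "(delta G R a g \<otimes>\<^bsub>partial_crossed_product G R \<alpha> D w u\<^esub> delta G R b h) k =
        delta G R c (g \<otimes>\<^bsub>G\<^esub> h) k"
      by (simp add: partial_crossed_product_def delta_def[of G R c])
  qed
qed

end

end

theory Submission
  imports Defs
begin

text \<open>For \<open>a \<in> D g\<close> and \<open>b \<in> D (g\<^sup>-\<^sup>1)\<close> the triple product \<open>(a \<delta>\<^sub>g)(b \<delta>\<^bsub>g\<^sup>-\<^sup>1\<^esub>)(a \<delta>\<^sub>g)\<close> equals
  \<open>a \<alpha>\<^sub>g(b) w\<^bsub>g,g\<^sup>-\<^sup>1\<^esub> a \<delta>\<^sub>g\<close>. Since \<open>\<alpha>\<^sub>g\<close> maps onto \<open>D g\<close> and \<open>w\<^bsub>g,g\<^sup>-\<^sup>1\<^esub>\<close> is invertible in \<open>D g\<close>,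
  every element of \<open>D g\<close>, in particular \<open>y 1\<^sub>g\<close> with \<open>a = a y a\<close>, is of the form \<open>\<alpha>\<^sub>g(b) w\<^bsub>g,g\<^sup>-\<^sup>1\<^esub>\<close>.
  Conversely, compare the coefficients of \<open>\<delta>\<^sub>e\<close> in \<open>a \<delta>\<^sub>e = (a \<delta>\<^sub>e) s (a \<delta>\<^sub>e)\<close>.\<close>

context unital_twisted_partial_action
begin

lemma D_u_absorb:
  assumes g: "g \<in> carrier G" and a: "a \<in> D g"
  shows "u g \<otimes>\<^bsub>R\<^esub> a = a" "a \<otimes>\<^bsub>R\<^esub> u g = a"
proof -
  obtain r where r: "r \<in> carrier R" "a = u g \<otimes>\<^bsub>R\<^esub> r"
    using a unfolding D_eq[OF g] l_coset_def by blast
  then show "u g \<otimes>\<^bsub>R\<^esub> a = a"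
    using u_closed[OF g] u_idem[OF g] by (simp flip: R.m_assoc)
  then show "a \<otimes>\<^bsub>R\<^esub> u g = a"
    using u_central[OF g D_carrier[OF g a]] by simp
qed

lemma u_one: "u \<one>\<^bsub>G\<^esub> = \<one>\<^bsub>R\<^esub>"
  using D_u_absorb(1)[OF G.one_closed, of "\<one>\<^bsub>R\<^esub>"] u_closed[OF G.one_closed]
  by (simp add: P1_D)

text \<open>Since \<open>g \<otimes> inv g\<close> is the neutral element, whose ideal is all of R
  with identity \<open>\<one>\<close>, the ring in which \<open>w g (inv g)\<close> is a unit has
  identity \<open>u g\<close>. Its inverse there also lies in \<open>D g\<close>.\<close>

lemma w_left_inverse:
  assumes g: "g \<in> carrier G"
  obtains v where "v \<in> D g" "v \<otimes>\<^bsub>R\<^esub> w g (inv\<^bsub>G\<^esub> g) = u g"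
proof -
  let ?D = "D g \<cdot>\<^bsub>R\<^esub> D (g \<otimes>\<^bsub>G\<^esub> inv\<^bsub>G\<^esub> g)"
  have "?D \<subseteq> D g"
    using R.ideal_prod_inter[OF D_ideal[OF g] D_ideal[OF G.one_closed]] g by simp
  moreover have "\<exists>v \<in> ?D. v \<otimes>\<^bsub>R\<^esub> w g (inv\<^bsub>G\<^esub> g) = u g \<otimes>\<^bsub>R\<^esub> u (g \<otimes>\<^bsub>G\<^esub> inv\<^bsub>G\<^esub> g)"
    using w_unit[OF g G.inv_closed[OF g]] unfolding Units_def ideal_as_ring_def by auto
  ultimately show thesis
    using that g u_closed[OF g] by (auto simp: u_one)
qed

lemma \<alpha>_surj:
  assumes "g \<in> carrier G" "d \<in> D g"
  obtains b where "b \<in> D (inv\<^bsub>G\<^esub> g)" "\<alpha> g b = d"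
proof -
  have "\<alpha> g ` D (inv\<^bsub>G\<^esub> g) = D g"
    using ring_iso_memE(5)[OF \<alpha>_iso[OF assms(1)]]
    by (simp add: bij_betw_def ideal_as_ring_def)
  with assms(2) have "d \<in> \<alpha> g ` D (inv\<^bsub>G\<^esub> g)"
    by simp
  then show thesis
    by (rule imageE) (rule that, simp_all)
qed

lemma D_mult:
  assumes "g \<in> carrier G" "a \<in> D g" "r \<in> carrier R"
  shows "r \<otimes>\<^bsub>R\<^esub> a \<in> D g" "a \<otimes>\<^bsub>R\<^esub> r \<in> D g"
  using ideal.I_l_closed[OF D_ideal] ideal.I_r_closed[OF D_ideal] assms by blast+

lemma delta_triple_product:
  assumes g: "g \<in> carrier G" and a: "a \<in> D g" and b: "b \<in> D (inv\<^bsub>G\<^esub> g)"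
  shows "delta G R a g \<otimes>\<^bsub>partial_crossed_product G R \<alpha> D w u\<^esub> delta G R b (inv\<^bsub>G\<^esub> g)
      \<otimes>\<^bsub>partial_crossed_product G R \<alpha> D w u\<^esub> delta G R a g =
    delta G R (a \<otimes>\<^bsub>R\<^esub> \<alpha> g b \<otimes>\<^bsub>R\<^esub> w g (inv\<^bsub>G\<^esub> g) \<otimes>\<^bsub>R\<^esub> a) g"
proof -
  have g': "inv\<^bsub>G\<^esub> g \<in> carrier G"
    using g by simp
  let ?c = "a \<otimes>\<^bsub>R\<^esub> \<alpha> g b \<otimes>\<^bsub>R\<^esub> w g (inv\<^bsub>G\<^esub> g)"
  have aR: "a \<in> carrier R"
    by (rule D_carrier[OF g a])
  have cR: "?c \<in> carrier R"
    using aR D_carrier[OF g \<alpha>_closed[OF g b]] w_closed(2)[OF g g'] by simp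
  show ?thesis
    \<comment> \<open>The first product has degree \<open>g \<otimes> inv g\<close>, the neutral
      element. There \<alpha> is the identity and the cocycle value is \<open>u g\<close>, which
      \<open>?c \<otimes> a\<close> absorbs because it lies in \<open>D g\<close>; so the second
      product adds no twist.\<close>
    using delta_mult[OF g g' a b] delta_mult[OF G.one_closed g, of ?c a] g a aR cR
    by (simp add: D_u_absorb(2)[OF g' b] D_u_absorb(2)[OF g D_mult(1)[OF g a cR]]
        P1_D P1_\<alpha> P4_left u_one)
qed

lemma crossed_closed_D:
  assumes "s \<in> carrier (partial_crossed_product G R \<alpha> D w u)" "g \<in> carrier G"
  shows "s g \<in> D g"
  using assms by (auto simp: partial_crossed_product_def)

lemma supp_delta: "g \<in> carrier G \<Longrightarrow> supp G R (delta G R a g) = (if a = \<zero>\<^bsub>R\<^esub> then {} else {g})"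
  by (auto simp: supp_def delta_def)

lemma delta_one_mult_coeff_one:
  assumes r: "r \<in> carrier R" and y: "y \<one>\<^bsub>G\<^esub> \<in> carrier R"
  shows "(delta G R r \<one>\<^bsub>G\<^esub> \<otimes>\<^bsub>partial_crossed_product G R \<alpha> D w u\<^esub> y) \<one>\<^bsub>G\<^esub> = r \<otimes>\<^bsub>R\<^esub> y \<one>\<^bsub>G\<^esub>"
proof -
  \<comment> \<open>The first factor forces \<open>i = \<one>\<close>, and then
    \<open>j = \<one>\<close>. If either coefficient vanishes, the sum is empty, in agreement with
    the product being zero.\<close>
  have S: "{(i, j) \<in> supp G R (delta G R r \<one>\<^bsub>G\<^esub>) \<times> supp G R y. i \<otimes>\<^bsub>G\<^esub> j = \<one>\<^bsub>G\<^esub>} =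
      (if r = \<zero>\<^bsub>R\<^esub> \<or> y \<one>\<^bsub>G\<^esub> = \<zero>\<^bsub>R\<^esub> then {} else {(\<one>\<^bsub>G\<^esub>, \<one>\<^bsub>G\<^esub>)})"
    unfolding supp_delta[OF G.one_closed] by (auto simp: supp_def)
  have "delta G R r \<one>\<^bsub>G\<^esub> \<one>\<^bsub>G\<^esub> = r"
    by (simp add: delta_def)
  then show ?thesis
    using r y unfolding partial_crossed_product_def monoid.simps restrict_apply'[OF G.one_closed] S
    by (simp add: u_one P1_\<alpha> P4_left)
qed

text \<open>Mirror image of the previous lemma: now \<open>j = \<one>\<close> forces
  \<open>i = \<one>\<close>. As only the coefficient of \<open>y\<close> at \<open>\<one>\<close> is
  constrained, \<open>y\<close> may itself be a product of the form \<open>a s\<close>.\<close>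

lemma mult_delta_one_coeff_one:
  assumes r: "r \<in> carrier R" and y: "y \<one>\<^bsub>G\<^esub> \<in> carrier R"
  shows "(y \<otimes>\<^bsub>partial_crossed_product G R \<alpha> D w u\<^esub> delta G R r \<one>\<^bsub>G\<^esub>) \<one>\<^bsub>G\<^esub> = y \<one>\<^bsub>G\<^esub> \<otimes>\<^bsub>R\<^esub> r"
proof -
  have S: "{(i, j) \<in> supp G R y \<times> supp G R (delta G R r \<one>\<^bsub>G\<^esub>). i \<otimes>\<^bsub>G\<^esub> j = \<one>\<^bsub>G\<^esub>} =
      (if r = \<zero>\<^bsub>R\<^esub> \<or> y \<one>\<^bsub>G\<^esub> = \<zero>\<^bsub>R\<^esub> then {} else {(\<one>\<^bsub>G\<^esub>, \<one>\<^bsub>G\<^esub>)})"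
    unfolding supp_delta[OF G.one_closed] by (auto simp: supp_def)
  have "delta G R r \<one>\<^bsub>G\<^esub> \<one>\<^bsub>G\<^esub> = r"
    by (simp add: delta_def)
  then show ?thesis
    using r y unfolding partial_crossed_product_def monoid.simps restrict_apply'[OF G.one_closed] S
    by (simp add: u_one P1_\<alpha> P4_left)
qed

lemma graded_regular_imp_regular:
  assumes "graded_von_neumann_regular G (partial_crossed_product G R \<alpha> D w u)
    (crossed_component G R D)"
  shows "von_neumann_regular R"
  unfolding von_neumann_regular_def
proof
  fix x assume x: "x \<in> carrier R"
  let ?S = "partial_crossed_product G R \<alpha> D w u"
  let ?a = "delta G R x \<one>\<^bsub>G\<^esub>"
  have "?a \<in> crossed_component G R D \<one>\<^bsub>G\<^esub>"
    using x by (auto simp: crossed_component_def P1_D)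
  then obtain s where s: "s \<in> carrier ?S" and eq: "?a = ?a \<otimes>\<^bsub>?S\<^esub> s \<otimes>\<^bsub>?S\<^esub> ?a"
    using assms by (auto simp: graded_von_neumann_regular_def)
  \<comment> \<open>The element \<open>s\<close> may have components in many degrees; its
    coefficient at the neutral element is the witness for \<open>x\<close>.\<close>
  have sR: "s \<one>\<^bsub>G\<^esub> \<in> carrier R"
    using crossed_closed_D[OF s G.one_closed] by (simp add: P1_D)
  have "x = ?a \<one>\<^bsub>G\<^esub>"
    by (simp add: delta_def)
  also have "\<dots> = (?a \<otimes>\<^bsub>?S\<^esub> s \<otimes>\<^bsub>?S\<^esub> ?a) \<one>\<^bsub>G\<^esub>"
    by (rule fun_cong[OF eq])
  also have "\<dots> = x \<otimes>\<^bsub>R\<^esub> s \<one>\<^bsub>G\<^esub> \<otimes>\<^bsub>R\<^esub> x"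
    using x sR by (simp add: mult_delta_one_coeff_one delta_one_mult_coeff_one)
  finally show "\<exists>y \<in> carrier R. x = x \<otimes>\<^bsub>R\<^esub> y \<otimes>\<^bsub>R\<^esub> x"
    using sR by blast
qed

lemma regular_imp_graded_regular:
  assumes "von_neumann_regular R"
  shows "graded_von_neumann_regular G (partial_crossed_product G R \<alpha> D w u)
    (crossed_component G R D)"
  unfolding graded_von_neumann_regular_def
proof (intro ballI)
  fix g x assume g: "g \<in> carrier G" and "x \<in> crossed_component G R D g"
  then obtain a where a: "a \<in> D g" and x: "x = delta G R a g"
    by (auto simp: crossed_component_def)
  have g': "inv\<^bsub>G\<^esub> g \<in> carrier G"
    using g by simp
  have aR: "a \<in> carrier R"
    by (rule D_carrier[OF g a])
  obtain y where y: "y \<in> carrier R" "a = a \<otimes>\<^bsub>R\<^esub> y \<otimes>\<^bsub>R\<^esub> a"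
    using assms aR unfolding von_neumann_regular_def by blast
  obtain v where v: "v \<in> D g" "v \<otimes>\<^bsub>R\<^esub> w g (inv\<^bsub>G\<^esub> g) = u g"
    using w_left_inverse[OF g] .
  have vR: "v \<in> carrier R"
    by (rule D_carrier[OF g v(1)])
  have wR: "w g (inv\<^bsub>G\<^esub> g) \<in> carrier R"
    by (rule w_closed(2)[OF g g'])
  \<comment> \<open>The factor \<open>v\<close> does two things: it puts
    \<open>y \<otimes> v\<close> into the ideal \<open>D g\<close>, the image of
    \<open>\<alpha> g\<close>, and it cancels the cocycle value \<open>w g (inv g)\<close> in the
    triple product.\<close>
  obtain b where b: "b \<in> D (inv\<^bsub>G\<^esub> g)" "\<alpha> g b = y \<otimes>\<^bsub>R\<^esub> v"
    using \<alpha>_surj[OF g D_mult(1)[OF g v(1) y(1)]] .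
  have "a \<otimes>\<^bsub>R\<^esub> \<alpha> g b \<otimes>\<^bsub>R\<^esub> w g (inv\<^bsub>G\<^esub> g) \<otimes>\<^bsub>R\<^esub> a
      = a \<otimes>\<^bsub>R\<^esub> y \<otimes>\<^bsub>R\<^esub> (v \<otimes>\<^bsub>R\<^esub> w g (inv\<^bsub>G\<^esub> g) \<otimes>\<^bsub>R\<^esub> a)"
    using aR y(1) vR wR by (simp add: b(2) R.m_assoc)
  \<comment> \<open>What remains of \<open>v\<close> and the cocycle is \<open>u g\<close>, which
    fixes \<open>a\<close>, leaving \<open>a y a\<close>.\<close>
  also have "\<dots> = a"
    by (simp add: v(2) D_u_absorb(1)[OF g a] flip: y(2))
  finally have "x = x \<otimes>\<^bsub>partial_crossed_product G R \<alpha> D w u\<^esub> delta G R b (inv\<^bsub>G\<^esub> g)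
      \<otimes>\<^bsub>partial_crossed_product G R \<alpha> D w u\<^esub> x"
    by (simp add: x delta_triple_product[OF g a b(1)])
  then show "\<exists>s \<in> carrier (partial_crossed_product G R \<alpha> D w u).
      x = x \<otimes>\<^bsub>partial_crossed_product G R \<alpha> D w u\<^esub> s \<otimes>\<^bsub>partial_crossed_product G R \<alpha> D w u\<^esub> x"
    using delta_closed[OF g' b(1)] by blast
qed

end

theorem corollary6p1:
  fixes G :: "('g, 'n) monoid_scheme"
    and R :: "('a, 'm) ring_scheme"
    and \<alpha> :: "'g \<Rightarrow> 'a \<Rightarrow> 'a"
    and D :: "'g \<Rightarrow> 'a set"
    and w :: "'g \<Rightarrow> 'g \<Rightarrow> 'a"
    and u :: "'g \<Rightarrow> 'a"
  assumes "group G"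
    and "ring R" and "\<one>\<^bsub>R\<^esub> \<noteq> \<zero>\<^bsub>R\<^esub>"
    and "unital_twisted_partial_action G R \<alpha> D w u"
  shows "graded_von_neumann_regular G (partial_crossed_product G R \<alpha> D w u) (crossed_component G R D)
    \<longleftrightarrow> von_neumann_regular R"
  using unital_twisted_partial_action.graded_regular_imp_regular[OF assms(4)]
    unital_twisted_partial_action.regular_imp_graded_regular[OF assms(4)] by blast

end
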